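(* Suppose $X$ is a compactum and $\omega_1\leq\kappa=\min_{p\in X}\pi\chi(p,X)$. Then there is a local $\langle\kappa,\omega\rangle$-splitter at some $p\in X$.
   Context: A compactum is a compact Hausdorff space; $\pi\chi(p,X)$ is the $\pi$-character of $p$. Given cardinals $\lambda\geq\mu\geq\omega$ and a point $p$ of a space $X$, a local $\langle\lambda,\mu\rangle$-splitter at $p$ is a set $\mathcal{U}$ of $\lambda$-many open neighborhoods of $p$ such that $p$ is not contained in the interior of $\bigcap\mathcal{V}$ for any $\mathcal{V}\in[\mathcal{U}]^\mu$. *)

theory Defs
  imports "HOL-Analysis.Analysis" "HOL-Library.Equipollence"
begin

definition compactum :: "'a topology \<Rightarrow> bool" where
  "compactum X \<longleftrightarrow> compact_space X \<and> Hausdorff_space X"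

definition local_pi_base :: "'a topology \<Rightarrow> 'a \<Rightarrow> 'a set set \<Rightarrow> bool" where
  "local_pi_base X p \<B> \<longleftrightarrow>
     (\<forall>V\<in>\<B>. openin X V \<and> V \<noteq> {}) \<and>
     (\<forall>U. openin X U \<and> p \<in> U \<longrightarrow> (\<exists>V\<in>\<B>. V \<subseteq> U))"

text \<open>pi-character: the least cardinality of a local pi-base at p, plus omega.
  Cardinals are represented by sets (compared by equipollence).
  pi_char_le X p K: pi-character of p is at most |K|.
  pi_char_ge X p K: pi-character of p is at least |K|.\<close>
definition pi_char_le :: "'a topology \<Rightarrow> 'a \<Rightarrow> 'k set \<Rightarrow> bool" where
  "pi_char_le X p K \<longleftrightarrow>
     (\<exists>\<B>. local_pi_base X p \<B> \<and> \<B> \<lesssim> K) \<and> (UNIV :: nat set) \<lesssim> K"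

definition pi_char_ge :: "'a topology \<Rightarrow> 'a \<Rightarrow> 'k set \<Rightarrow> bool" where
  "pi_char_ge X p K \<longleftrightarrow>
     (\<forall>\<B>. local_pi_base X p \<B> \<longrightarrow> (K \<lesssim> \<B> \<or> K \<lesssim> (UNIV :: nat set)))"

definition min_pi_character :: "'a topology \<Rightarrow> 'k set \<Rightarrow> bool" where
  "min_pi_character X K \<longleftrightarrow>
     (\<forall>p\<in>topspace X. pi_char_ge X p K) \<and> (\<exists>p\<in>topspace X. pi_char_le X p K)"

definition local_splitter ::
    "'a topology \<Rightarrow> 'a \<Rightarrow> 'a set set \<Rightarrow> 'l set \<Rightarrow> 'm set \<Rightarrow> bool" where
  "local_splitter X p \<U> L M \<longleftrightarrow>
     \<U> \<approx> L \<and> (\<forall>U\<in>\<U>. openin X U \<and> p \<in> U) \<and>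
     (\<forall>\<V>. \<V> \<subseteq> \<U> \<and> \<V> \<approx> M \<longrightarrow> p \<notin> X interior_of (\<Inter>\<V>))"

end

theory Submission
  imports Defs
begin

text \<open>
  Following Shapirovskii, one finds \<open>\<kappa>\<close> pairs of open sets with disjoint closures that are
  independent: every finite choice of sides has nonempty intersection. A minimal closed set \<open>Y\<close>
  meeting all finite intersections of closures of sides then has the property that a
  neighbourhood of any \<open>p \<in> Y\<close> meets both sides of all but finitely many pairs; the
  complements of the closures of those sides that avoid \<open>p\<close> form the splitter.

  To enlarge a family of fewer than \<open>\<kappa>\<close> pairs, note that its finite intersections form no
  local \<open>\<pi>\<close>-base at any point, so finitely many open sets containing none of them cover
  the space. An induction on the size of this cover yields a new pair that is independent of the old
  ones below some finite intersection. For regular \<open>\<kappa>\<close> a pressing-down argument makes this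
  finite condition constant for \<open>\<kappa>\<close> many pairs; for singular \<open>\<kappa>\<close> one glues blocks of
  regular length along a cofinal sequence.
\<close>

section \<open>Separated independent pairs\<close>

text \<open>The pair with index \<open>i\<close> consists of \<open>G (i, True)\<close> and \<open>G (i, False)\<close>; a set
  \<open>\<rho>\<close> of index-sign pairs with \<open>inj_on fst \<rho>\<close> is a choice of one side for each index
  occurring in it.\<close>

definition independent_over ::
    "'a set set \<Rightarrow> ('i \<times> bool \<Rightarrow> 'a set) \<Rightarrow> 'i set \<Rightarrow> bool" where
  "independent_over \<S> G I \<longleftrightarrow>
     (\<forall>H\<in>\<S>. \<forall>\<rho>. finite \<rho> \<and> \<rho> \<subseteq> I \<times> UNIV \<and> inj_on fst \<rho> \<longrightarrow> H \<inter> \<Inter>(G ` \<rho>) \<noteq> {})"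

definition separated_pairs ::
    "'a topology \<Rightarrow> ('i \<times> bool \<Rightarrow> 'a set) \<Rightarrow> 'i set \<Rightarrow> bool" where
  "separated_pairs X G I \<longleftrightarrow>
     (\<forall>i\<in>I. openin X (G (i, True)) \<and> openin X (G (i, False)) \<and>
        disjnt (X closure_of G (i, True)) (X closure_of G (i, False)))"

lemma separated_pairs_openin:
  assumes "separated_pairs X G I" "x \<in> I \<times> UNIV"
  shows "openin X (G x)"
  using assms unfolding separated_pairs_def by (metis (full_types) SigmaE)

text \<open>A maximal open set \<open>W\<close> containing no finite consistent intersection of the closures: its
  complement is a minimal closed set meeting all of them, and every point of it works.\<close>

lemma local_splitter_of_independent:
  fixes X :: "'a topology" and G :: "'i \<times> bool \<Rightarrow> 'a set"
  assumes X: "compact_space X" and sep: "separated_pairs X G I"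
    and ind: "independent_over {topspace X} G I"
  shows "\<exists>p\<in>topspace X. \<exists>\<U>. local_splitter X p \<U> I (UNIV :: nat set)"
proof -
  define F where "F x = X closure_of G x" for x
  define R where "R = {\<rho>. finite \<rho> \<and> \<rho> \<subseteq> I \<times> (UNIV :: bool set) \<and> inj_on fst \<rho>}"
  \<comment> \<open>The factor \<open>topspace X\<close> makes \<open>M {}\<close> the whole space,
    because \<open>\<Inter>{}\<close> is \<open>UNIV\<close>.\<close>
  define M where "M \<rho> = topspace X \<inter> \<Inter>(F ` \<rho>)" for \<rho>
  define \<W> where "\<W> = {W. openin X W \<and> (\<forall>\<rho>\<in>R. \<not> M \<rho> \<subseteq> W)}"
  have Fcl: "closedin X (F x)" for x
    by (simp add: F_def)
  have GF: "G x \<subseteq> F x" if "x \<in> I \<times> UNIV" for x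
    using separated_pairs_openin[OF sep that] by (simp add: F_def closure_of_subset openin_subset)
  have Mne: "M \<rho> \<noteq> {}" if "\<rho> \<in> R" for \<rho>
  proof -
    have "topspace X \<inter> \<Inter>(G ` \<rho>) \<noteq> {}" "\<rho> \<subseteq> I \<times> UNIV"
      using ind that unfolding independent_over_def R_def by blast+
    then show ?thesis
      using GF unfolding M_def by blast
  qed
  have Mcpt: "compactin X (M \<rho>)" for \<rho>
  proof -
    have "closedin X (M \<rho>)"
      unfolding M_def using Fcl
      by (cases "\<rho> = {}") (auto intro!: closedin_Inter closedin_Int)
    then show ?thesis
      using X closedin_compact_space by blast
  qed
  have "\<exists>W\<in>\<W>. \<forall>W'\<in>\<W>. W \<subseteq> W' \<longrightarrow> W' = W"
  proof (rule subset_Zorn')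
    fix \<C> assume ch: "subset.chain \<W> \<C>"
    then have sub: "\<C> \<subseteq> \<W>"
      by (simp add: subset_chain_def)
    \<comment> \<open>By compactness finitely many members of the chain would cover
      \<open>M \<rho>\<close>, hence so would the largest of them.\<close>
    have "\<not> M \<rho> \<subseteq> \<Union>\<C>" if \<rho>: "\<rho> \<in> R" for \<rho>
    proof
      assume "M \<rho> \<subseteq> \<Union>\<C>"
      then obtain \<F> where \<F>: "finite \<F>" "\<F> \<subseteq> \<C>" "M \<rho> \<subseteq> \<Union>\<F>"
        using compactinD[OF Mcpt[of \<rho>], of \<C>] sub unfolding \<W>_def by blast
      then have ne: "\<F> \<noteq> {}"
        using Mne[OF \<rho>] by auto
      have "subset.chain \<W> \<F>"
        using ch \<F>(2) unfolding subset_chain_def by (meson subsetD subset_trans)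
      then have "\<Union>\<F> \<in> \<F>"
        using Union_in_chain \<F>(1) ne by blast
      then show False
        using \<F> sub \<rho> unfolding \<W>_def by blast
    qed
    moreover have "openin X (\<Union>\<C>)"
      using sub unfolding \<W>_def by blast
    ultimately show "\<Union>\<C> \<in> \<W>"
      unfolding \<W>_def by blast
  qed
  then obtain W where W: "W \<in> \<W>" and Wmax: "\<And>W'. W' \<in> \<W> \<Longrightarrow> W \<subseteq> W' \<Longrightarrow> W' = W"
    by blast
  have "{} \<in> R"
    by (simp add: R_def)
  then obtain p where p: "p \<in> topspace X" "p \<notin> W"
    using W unfolding \<W>_def M_def by auto
  have meets: "finite {i\<in>I. \<exists>b. V \<inter> F (i, b) = {}}" if V: "openin X V" "p \<in> V" for V
  proof -
    have "W \<union> V \<notin> \<W>"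
      using Wmax[of "W \<union> V"] V p by blast
    moreover have "openin X (W \<union> V)"
      using W V unfolding \<W>_def by blast
    ultimately obtain \<rho> where \<rho>: "\<rho> \<in> R" "M \<rho> \<subseteq> W \<union> V"
      unfolding \<W>_def by blast
    have "V \<inter> F (i, b) \<noteq> {}" if "i \<in> I" "i \<notin> fst ` \<rho>" for i b
    proof -
      have "insert (i, b) \<rho> \<in> R"
        using \<rho>(1) that unfolding R_def by (auto simp: inj_on_insert)
      then have "\<not> M (insert (i, b) \<rho>) \<subseteq> W"
        using W unfolding \<W>_def by blast
      moreover have "M (insert (i, b) \<rho>) = M \<rho> \<inter> F (i, b)"
        unfolding M_def by blast
      ultimately show ?thesis
        using \<rho>(2) by blast
    qed
    then have "{i\<in>I. \<exists>b. V \<inter> F (i, b) = {}} \<subseteq> fst ` \<rho>"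
      by blast
    then show ?thesis
      using \<rho>(1) unfolding R_def by (metis (no_types, lifting) finite_imageI finite_subset mem_Collect_eq)
  qed
  have "\<exists>b. p \<notin> F (i, b)" if "i \<in> I" for i
    using sep that unfolding separated_pairs_def F_def disjnt_iff by blast
  then obtain b where b: "\<And>i. i \<in> I \<Longrightarrow> p \<notin> F (i, b i)"
    by metis
  define U where "U i = topspace X - F (i, b i)" for i
  \<comment> \<open>Injectivity gives the splitter the cardinality of \<open>I\<close>. If
    \<open>U i = U j\<close> with \<open>i \<noteq> j\<close>, then a closed side of
    \<open>i\<close> equals one of \<open>j\<close> and misses the opposite side of
    \<open>j\<close>, against independence.\<close>
  have "inj_on U I"
  proof
    fix i j assume ij: "i \<in> I" "j \<in> I" "U i = U j"
    show "i = j"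
    proof (rule ccontr)
      assume "i \<noteq> j"
      have "F (i, b i) = F (j, b j)"
        using ij(3) Fcl closedin_subset unfolding U_def by blast
      moreover have "disjnt (F (j, b j)) (F (j, \<not> b j))"
        using sep ij(2) unfolding separated_pairs_def F_def disjnt_sym by (cases "b j") (auto simp: disjnt_sym)
      moreover have "{(i, b i), (j, \<not> b j)} \<in> R"
        using ij \<open>i \<noteq> j\<close> unfolding R_def by auto
      then have "M {(i, b i), (j, \<not> b j)} \<noteq> {}"
        by (rule Mne)
      ultimately show False
        unfolding M_def disjnt_iff by auto
    qed
  qed
  have "local_splitter X p (U ` I) I (UNIV :: nat set)"
    unfolding local_splitter_def
  proof (intro conjI allI impI ballI)
    show "U ` I \<approx> I"
      using \<open>inj_on U I\<close> inj_on_image_eqpoll_self by blast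
    fix u assume "u \<in> U ` I"
    then show "openin X u" "p \<in> u"
      using Fcl b p unfolding U_def by auto
  next
    fix \<V> assume \<V>: "\<V> \<subseteq> U ` I \<and> \<V> \<approx> (UNIV :: nat set)"
    show "p \<notin> X interior_of \<Inter>\<V>"
    proof
      assume pV: "p \<in> X interior_of \<Inter>\<V>"
      define V where "V = X interior_of \<Inter>\<V>"
      have "V \<subseteq> u" if "u \<in> \<V>" for u
        using that interior_of_subset[of X "\<Inter>\<V>"] unfolding V_def by blast
      \<comment> \<open>A set \<open>V\<close> contained in \<open>U i\<close> misses
        \<open>F (i, b i)\<close>, which by \<open>meets\<close> happens for finitely many
        \<open>i\<close> only.\<close>
      then have "\<V> \<subseteq> U ` {i\<in>I. \<exists>b. V \<inter> F (i, b) = {}}"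
        using \<V> unfolding U_def by blast
      moreover have "finite {i\<in>I. \<exists>b. V \<inter> F (i, b) = {}}"
        using meets pV by (simp add: V_def)
      ultimately have "finite \<V>"
        by (meson finite_imageI finite_subset)
      then show False
        using \<V> eqpoll_finite_iff infinite_UNIV_nat by blast
    qed
  qed
  then show ?thesis
    using p by blast
qed

section \<open>Construction of one new separated pair\<close>

lemma separated_pair_below:
  assumes X: "normal_space X"
    and \<S>: "\<And>H. H \<in> \<S> \<Longrightarrow> openin X H \<and> H \<noteq> {}"
    and "finite \<E>" "H0 \<in> \<S>"
    and "\<And>E. E \<in> \<E> \<Longrightarrow> closedin X E"
    and "\<And>E H. E \<in> \<E> \<Longrightarrow> H \<in> \<S> \<Longrightarrow> H \<subseteq> H0 \<Longrightarrow> H \<inter> E \<noteq> {}"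
    and "X closure_of H0 \<inter> \<Inter>\<E> = {}"
  shows "\<exists>H\<in>\<S>. \<exists>O1 O2. H \<subseteq> H0 \<and> openin X O1 \<and> openin X O2 \<and>
           disjnt (X closure_of O1) (X closure_of O2) \<and>
           (\<forall>H'\<in>\<S>. H' \<subseteq> H \<longrightarrow> H' \<inter> O1 \<noteq> {} \<and> H' \<inter> O2 \<noteq> {})"
  using assms(3-)
proof (induction \<E> arbitrary: H0 rule: finite_induct)
  case empty
  \<comment> \<open>Since \<open>\<Inter>{}\<close> is \<open>UNIV\<close>, the last hypothesis says
    that the closure of \<open>H0\<close> is empty.\<close>
  then have "H0 = {}"
    using \<S>[of H0] closure_of_subset[of H0 X] openin_subset[of X H0] by auto
  then show ?case
    using \<S>[OF empty.prems(1)] by blast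
next
  case (insert E \<E>)
  let ?C = "X closure_of H0"
  have "closedin X (?C \<inter> \<Inter>\<E>)"
  proof (cases "\<E> = {}")
    case False
    then show ?thesis
      using insert.prems(2) by (intro closedin_Int closedin_Inter) simp_all
  qed simp
  moreover have "closedin X (?C \<inter> E)"
    using insert.prems(2)[of E] by (simp add: closedin_Int)
  moreover have "disjnt (?C \<inter> \<Inter>\<E>) (?C \<inter> E)"
    using insert.prems(4) by (auto simp: disjnt_def)
  ultimately obtain O1 O2 where O: "openin X O1" "openin X O2" "?C \<inter> \<Inter>\<E> \<subseteq> O1" "?C \<inter> E \<subseteq> O2"
      "disjnt (X closure_of O1) (X closure_of O2)"
    using X unfolding normal_space_disjoint_closures by meson
  have C: "H0 \<subseteq> ?C"
    using \<S> insert.prems(1) by (simp add: closure_of_subset openin_subset)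
  show ?case
  proof (cases "\<forall>H\<in>\<S>. H \<subseteq> H0 \<longrightarrow> H \<inter> O1 \<noteq> {}")
    case True
    moreover have "H \<inter> O2 \<noteq> {}" if "H \<in> \<S>" "H \<subseteq> H0" for H
      using insert.prems(3)[OF insertI1 that] that C O(4) by blast
    ultimately show ?thesis
      using O(1,2,5) by (intro bexI[OF _ insert.prems(1)] exI[of _ O1] exI[of _ O2]) simp
  next
    case False
    then obtain H1 where H1: "H1 \<in> \<S>" "H1 \<subseteq> H0" "H1 \<inter> O1 = {}"
      by blast
    then have "X closure_of H1 \<inter> O1 = {}"
      using O(1) openin_Int_closure_of_eq_empty by (metis inf_commute)
    moreover have "X closure_of H1 \<subseteq> ?C"
      by (simp add: H1 closure_of_mono)
    ultimately have "X closure_of H1 \<inter> \<Inter>\<E> = {}"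
      using O(3) by blast
    then have "\<exists>H\<in>\<S>. \<exists>O1 O2. H \<subseteq> H1 \<and> openin X O1 \<and> openin X O2 \<and>
           disjnt (X closure_of O1) (X closure_of O2) \<and>
           (\<forall>H'\<in>\<S>. H' \<subseteq> H \<longrightarrow> H' \<inter> O1 \<noteq> {} \<and> H' \<inter> O2 \<noteq> {})"
    proof (intro insert.IH[OF H1(1)])
      show "closedin X E'" if "E' \<in> \<E>" for E'
        using insert.prems(2) that by simp
      show "H \<inter> E' \<noteq> {}" if "E' \<in> \<E>" "H \<in> \<S>" "H \<subseteq> H1" for E' H
        using insert.prems(3)[of E' H] that H1(2) by simp
    qed
    then show ?thesis
      using H1(2) subset_trans by metis
  qed
qed

text \<open>Every point has an open neighbourhood containing no member of \<open>\<S>\<close>, and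
  finitely many of these cover the space. Their complements have empty intersection, yet each of
  them meets every member of \<open>\<S>\<close>.\<close>

lemma separated_pair_exists:
  assumes X: "compactum X"
    and \<S>: "\<And>H. H \<in> \<S> \<Longrightarrow> openin X H \<and> H \<noteq> {}" and "\<S> \<noteq> {}"
    and nb: "\<And>p. p \<in> topspace X \<Longrightarrow> \<not> local_pi_base X p \<S>"
  shows "\<exists>H\<in>\<S>. \<exists>O1 O2. openin X O1 \<and> openin X O2 \<and>
           disjnt (X closure_of O1) (X closure_of O2) \<and>
           (\<forall>H'\<in>\<S>. H' \<subseteq> H \<longrightarrow> H' \<inter> O1 \<noteq> {} \<and> H' \<inter> O2 \<noteq> {})"
proof -
  have cpt: "compact_space X" and norm: "normal_space X"
    using X compact_Hausdorff_or_regular_imp_normal_space by (auto simp: compactum_def)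
  define \<O> where "\<O> = {U. openin X U \<and> (\<forall>H\<in>\<S>. \<not> H \<subseteq> U)}"
  have "topspace X \<subseteq> \<Union>\<O>"
  proof
    fix p assume "p \<in> topspace X"
    then obtain U where "openin X U" "p \<in> U" "\<forall>V\<in>\<S>. \<not> V \<subseteq> U"
      using nb[of p] \<S> unfolding local_pi_base_def by meson
    then show "p \<in> \<Union>\<O>"
      unfolding \<O>_def by blast
  qed
  then obtain \<F> where \<F>: "finite \<F>" "\<F> \<subseteq> \<O>" "topspace X \<subseteq> \<Union>\<F>"
    using compactinD[OF cpt[unfolded compact_space_def], of \<O>] unfolding \<O>_def by blast
  obtain H0 where H0: "H0 \<in> \<S>"
    using \<open>\<S> \<noteq> {}\<close> by blast
  let ?E = "(\<lambda>U. topspace X - U) ` \<F>"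
  have 1: "closedin X E" if "E \<in> ?E" for E
    using that \<F>(2) unfolding \<O>_def by blast
  have 2: "H \<inter> E \<noteq> {}" if "E \<in> ?E" "H \<in> \<S>" "H \<subseteq> H0" for E H
    using that(1,2) \<F>(2) \<S>[OF that(2)] openin_subset[of X H] unfolding \<O>_def by blast
  have 3: "X closure_of H0 \<inter> \<Inter>?E = {}"
    using \<F>(3) closure_of_subset_topspace[of X H0] by blast
  have "\<exists>H\<in>\<S>. \<exists>O1 O2. H \<subseteq> H0 \<and> openin X O1 \<and> openin X O2 \<and>
           disjnt (X closure_of O1) (X closure_of O2) \<and>
           (\<forall>H'\<in>\<S>. H' \<subseteq> H \<longrightarrow> H' \<inter> O1 \<noteq> {} \<and> H' \<inter> O2 \<noteq> {})"
    by (rule separated_pair_below[where \<E> = ?E]) (fact norm \<S> finite_imageI[OF \<F>(1)] H0 1 2 3)+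
  then show ?thesis
    by meson
qed

section \<open>Regular cardinals and regressive finite sets\<close>

no_notation elt_set_eq (infix \<open>=o\<close> 50)
unbundle cardinal_syntax

section \<open>Cardinal arithmetic below an uncountable cardinal\<close>

lemma infinite_Field_of_natLeq_ordLess:
  assumes "natLeq <o r"
  shows "infinite (Field r)"
  using assms card_of_mono2[of natLeq r] card_of_ordLeq_infinite[of "UNIV :: nat set"]
  by (metis Field_natLeq infinite_UNIV_nat ordLess_imp_ordLeq)

lemma countable_ordLess:
  assumes "natLeq <o r" "countable A"
  shows "|A| <o r"
proof -
  have "|A| \<le>o |UNIV :: nat set|"
    using assms(2) by (metis card_of_ordLeq countable_def top_greatest)
  then have "|A| \<le>o natLeq"
    using card_of_nat ordLeq_ordIso_trans by blast
  then show ?thesis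
    using assms(1) ordLeq_ordLess_trans by blast
qed

lemma card_of_Times_ordLess_infinite_Field:
  assumes "natLeq <o r" "Card_order r" "|A| <o r" "|B| <o r"
  shows "|A \<times> B| <o r"
proof -
  \<comment> \<open>One set below \<open>r\<close> that dominates both factors; the summand
    \<open>nat\<close> keeps it infinite when \<open>A\<close> and \<open>B\<close> are
    finite.\<close>
  let ?C = "(A <+> B) <+> (UNIV :: nat set)"
  have inf: "infinite (Field r)"
    by (rule infinite_Field_of_natLeq_ordLess) fact
  have "|UNIV :: nat set| <o r"
    by (rule countable_ordLess[OF assms(1)]) simp
  then have C: "|?C| <o r"
    using assms inf by (intro card_of_Plus_ordLess_infinite_Field)
  have "|A| \<le>o |?C|" "|B| \<le>o |?C|"
    by (meson card_of_Plus1 card_of_Plus2 ordLeq_transitive)+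
  moreover have "infinite ?C"
    by auto
  ultimately have "|A \<times> B| \<le>o |?C|"
    by (intro card_of_Sigma_ordLeq_infinite) auto
  then show ?thesis
    using C ordLeq_ordLess_trans by blast
qed

text \<open>Finite subsets are the sets of entries of lists; over an infinite \<open>A\<close> there
  are at most \<open>|A|\<close> lists of each length. For finite \<open>A\<close> countability
  suffices.\<close>

lemma card_of_Fpow_ordLess:
  assumes "natLeq <o r" "Card_order r" "|A| <o r"
  shows "|Fpow A| <o r"
proof (cases "finite A")
  case True
  then show ?thesis
    using assms(1) countable_Fpow countable_finite countable_ordLess by blast
next
  case False
  define L where "L n = {xs. set xs \<subseteq> A \<and> length xs = n}" for n
  have "|L n| \<le>o |A|" for n
  proof (induction n)
    case 0
    have "L 0 = {[]}"
      by (auto simp: L_def)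
    then show ?case
      using False by (auto intro: card_of_singl_ordLeq)
  next
    case (Suc n)
    have "L (Suc n) \<subseteq> (\<lambda>(x, xs). x # xs) ` (A \<times> L n)"
      unfolding L_def by (auto simp: length_Suc_conv)
    then have "|L (Suc n)| \<le>o |A \<times> L n|"
      by (rule surj_imp_ordLeq)
    also have "|A \<times> L n| \<le>o |A|"
      using False Suc by (intro card_of_Sigma_ordLeq_infinite) (auto intro: card_of_mono1)
    finally show ?case .
  qed
  then have "|\<Union>n. L n| \<le>o |A|"
    using False infinite_iff_card_of_nat by (intro card_of_UNION_ordLeq_infinite) auto
  moreover have "Fpow A \<subseteq> set ` (\<Union>n. L n)"
  proof
    fix S assume "S \<in> Fpow A"
    then obtain xs where "set xs = S" "S \<subseteq> A"
      using finite_list[of S] by (auto simp: Fpow_def)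
    then show "S \<in> set ` (\<Union>n. L n)"
      unfolding L_def by auto
  qed
  then have "|Fpow A| \<le>o |\<Union>n. L n|"
    by (rule surj_imp_ordLeq)
  ultimately show ?thesis
    using assms(3) ordLeq_ordLess_trans ordLeq_transitive by blast
qed

section \<open>Bounds and pressing down on regular cardinals\<close>

lemma Well_order_linear:
  assumes "Well_order r" "a \<in> Field r" "b \<in> Field r"
  shows "(a, b) \<in> r \<or> (b, a) \<in> r"
  using assms wo_rel.TOTALS[of r] by (simp add: wo_rel_def)

lemma Well_order_finite_has_max:
  assumes "Well_order r" "finite A" "A \<noteq> {}" "A \<subseteq> Field r"
  obtains a where "a \<in> A" "A \<subseteq> under r a"
proof -
  have "\<exists>a\<in>A. A \<subseteq> under r a"
    using assms(2-)
  proof (induction A rule: finite_ne_induct)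
    case (singleton x)
    then show ?case
      using Well_order_linear[OF assms(1), of x x] by (auto simp: under_def)
  next
    case (insert x A)
    then obtain a where a: "a \<in> A" "A \<subseteq> under r a"
      by auto
    have tr: "trans r"
      using assms(1) by (simp add: order_on_defs)
    have "(x, a) \<in> r \<or> (a, x) \<in> r" "(x, x) \<in> r"
      using insert.prems a(1) Well_order_linear[OF assms(1)] by auto
    then show ?case
      using a transD[OF tr] unfolding under_def by blast
  qed
  then show ?thesis
    using that by blast
qed

text \<open>By regularity \<open>A\<close> is not cofinal. As \<open>cofinal\<close> asks for
  strictly larger elements, this gives only a weak bound \<open>a\<close>; a strict one exists
  because an infinite cardinal is a limit.\<close>

lemma regularCard_bounded:
  assumes r: "Card_order r" "regularCard r" "infinite (Field r)"
    and A: "A \<subseteq> Field r" "|A| <o r"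
  obtains a where "a \<in> Field r" "A \<subseteq> underS r a"
proof -
  have "\<not> cofinal A r"
    using r(2) A not_ordLess_ordIso unfolding regularCard_def by blast
  then obtain a where a: "a \<in> Field r" "\<And>b. b \<in> A \<Longrightarrow> a = b \<or> (a, b) \<notin> r"
    unfolding cofinal_def by blast
  have "trans r" "antisym r"
    using r(1) by (auto simp: card_order_on_def well_order_on_def linear_order_on_def
        partial_order_on_def preorder_on_def)
  obtain a' where a': "a' \<in> Field r" "a \<noteq> a'" "(a, a') \<in> r"
    using infinite_Card_order_limit[OF r(1,3) a(1)] by blast
  have "b \<in> underS r a'" if "b \<in> A" for b
  proof -
    have "(b, a) \<in> r"
      using a(2)[OF that] Well_order_linear[OF Card_order_wo_rel[OF r(1), unfolded wo_rel_def] a(1), of b]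
        A(1) that by auto
    then show ?thesis
      using a' \<open>trans r\<close> \<open>antisym r\<close> unfolding underS_def trans_def antisym_def by blast
  qed
  then show ?thesis
    using that a'(1) by blast
qed

lemma card_of_under_ordLess:
  assumes "natLeq <o r" "Card_order r" "a \<in> Field r"
  shows "|under r a| <o r"
proof -
  have "under r a \<subseteq> {a} \<union> underS r a"
    by (auto simp: under_def underS_def)
  moreover have "|{a}| <o r"
    by (rule countable_ordLess[OF assms(1)]) simp
  then have "|{a} \<union> underS r a| <o r"
    using assms card_of_underS infinite_Field_of_natLeq_ordLess
    by (intro card_of_Un_ordLess_infinite_Field)
  ultimately show ?thesis
    using card_of_mono1 ordLeq_ordLess_trans by blast
qed

text \<open>A substitute for Fodor's lemma: if the claim failed, iterating a bound countably often would
  produce a point \<open>\<delta>\<close> of cofinality \<open>\<omega>\<close> closed under the bounds, but the finite set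
  \<open>D \<delta>\<close> is bounded below \<open>\<delta>\<close>.\<close>

lemma regressive_finite_sets:
  assumes r: "Card_order r" "regularCard r" "natLeq <o r"
    and D: "\<And>a. a \<in> Field r \<Longrightarrow> finite (D a) \<and> D a \<subseteq> underS r a"
  shows "\<exists>d\<in>Field r. |{a \<in> Field r. D a \<subseteq> under r d}| =o r"
proof (rule ccontr)
  assume no: "\<not> ?thesis"
  define M where "M d = {a \<in> Field r. D a \<subseteq> under r d}" for d
  have inf: "infinite (Field r)"
    by (rule infinite_Field_of_natLeq_ordLess) fact
  have wo: "well_order_on (Field r) r"
    using r(1) by (simp add: card_order_on_def)
  have refl: "refl_on (Field r) r" and tr: "trans r"
    and as: "antisym r" and wf: "wf (r - Id)"
    using wo by (auto simp: well_order_on_def linear_order_on_def partial_order_on_def preorder_on_def)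
  have small: "|M d| <o r" if "d \<in> Field r" for d
  proof -
    have "|M d| \<le>o r"
      using card_of_mono1[of "M d" "Field r"] card_of_Field_ordIso[OF r(1)] ordLeq_ordIso_trans
      unfolding M_def by blast
    then show ?thesis
      using no that unfolding M_def using ordLeq_iff_ordLess_or_ordIso by blast
  qed
  \<comment> \<open>The assumed failure makes \<open>M d\<close> small, so regularity bounds it;
    including \<open>d\<close> itself makes the iterates of \<open>g\<close> strictly
    increasing.\<close>
  have "\<exists>g\<in>Field r. insert d (M d) \<subseteq> underS r g" if "d \<in> Field r" for d
  proof (rule regularCard_bounded[OF r(1,2) inf])
    show "insert d (M d) \<subseteq> Field r"
      using that by (auto simp: M_def)
    show "|insert d (M d)| <o r"
      using card_of_Un_ordLess_infinite_Field[OF inf r(1) _ small[OF that], of "{d}"]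
        countable_ordLess[OF r(3), of "{d}"] by simp
  qed blast
  then obtain g where g: "\<And>d. d \<in> Field r \<Longrightarrow> g d \<in> Field r \<and> insert d (M d) \<subseteq> underS r (g d)"
    by metis
  obtain d0 where d0: "d0 \<in> Field r"
    using inf by fastforce
  define e where "e n = (g ^^ n) d0" for n
  have eF: "e n \<in> Field r" for n
    by (induction n) (use d0 g in \<open>auto simp: e_def\<close>)
  have eS: "insert (e n) (M (e n)) \<subseteq> underS r (e (Suc n))" for n
    using g[OF eF[of n]] by (simp add: e_def)
  have emono: "(e m, e n) \<in> r" if "m \<le> n" for m n
    using that
  proof (induction n rule: dec_induct)
    case base
    show ?case
      using eF refl by (meson refl_onD)
  next
    case (step n)
    have "(e n, e (Suc n)) \<in> r"
      using eS[of n] by (auto simp: underS_def)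
    then show ?case
      using step.IH tr by (meson transD)
  qed
  define B where "B = {b \<in> Field r. range e \<subseteq> underS r b}"
  have "|range e| <o r"
    by (rule countable_ordLess[OF r(3)]) simp
  then obtain b where "b \<in> B"
    using regularCard_bounded[OF r(1,2) inf, of "range e"] eF unfolding B_def
    by (metis (mono_tags, lifting) image_subsetI mem_Collect_eq)
  \<comment> \<open>This \<open>d\<close> is the supremum of the iterates: anything strictly below
    it is bounded by some \<open>e n\<close>.\<close>
  then obtain d where d: "d \<in> B" "\<And>b. (b, d) \<in> r - Id \<Longrightarrow> b \<notin> B"
    using wfE_min[OF wf] by metis
  have dF: "d \<in> Field r" and de: "e n \<in> underS r d" for n
    using d(1) by (auto simp: B_def)
  have "\<exists>n. (x, e n) \<in> r" if "x \<in> D d" for x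
  proof -
    have x: "(x, d) \<in> r - Id"
      using D[OF dF] that by (auto simp: underS_def)
    then have xF: "x \<in> Field r"
      by (auto simp: Field_def)
    then obtain n where "e n \<notin> underS r x"
      using d(2)[OF x] unfolding B_def by blast
    then show ?thesis
      using Well_order_linear[OF wo xF eF[of n]] unfolding underS_def
      by (metis (mono_tags, lifting) mem_Collect_eq)
  qed
  then obtain N where N: "\<And>x. x \<in> D d \<Longrightarrow> (x, e (N x)) \<in> r"
    by metis
  \<comment> \<open>The inserted \<open>0\<close> covers the case of an empty
    \<open>D d\<close>.\<close>
  define n where "n = Max (insert 0 (N ` D d))"
  have "(x, e n) \<in> r" if "x \<in> D d" for x
  proof -
    have "N x \<le> n"
      unfolding n_def using D[OF dF] that by (intro Max_ge) auto
    then show ?thesis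
      using N[OF that] emono tr by (meson transD)
  qed
  then have "d \<in> M (e n)"
    using dF by (auto simp: M_def under_def)
  then have "(d, e (Suc n)) \<in> r" "d \<noteq> e (Suc n)"
    using eS[of n] by (auto simp: underS_def)
  then show False
    using de[of "Suc n"] as unfolding underS_def antisym_def by blast
qed

text \<open>Otherwise \<open>M\<close> would be a union of fewer than \<open>r\<close> fibres, each
  smaller than \<open>r\<close>, against regularity.\<close>

lemma regularCard_constant_on_large:
  assumes r: "Card_order r" "regularCard r" "natLeq <o r"
    and M: "|M| =o r" and s: "|s ` M| <o r"
  shows "\<exists>c\<in>s ` M. |{a \<in> M. s a = c}| =o r"
proof (rule ccontr)
  assume no: "\<not> ?thesis"
  have "|{a \<in> M. s a = c}| <o r" if "c \<in> s ` M" for c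
  proof -
    have "|{a \<in> M. s a = c}| \<le>o r"
      using card_of_mono1[of "{a \<in> M. s a = c}" M] M ordLeq_ordIso_trans by blast
    then show ?thesis
      using no that ordLeq_iff_ordLess_or_ordIso by blast
  qed
  moreover have "Cinfinite r"
    using r infinite_Field_of_natLeq_ordLess by (auto simp: cinfinite_def)
  ultimately have "|\<Union>c\<in>s ` M. {a \<in> M. s a = c}| <o r"
    by (intro card_of_UNION_ordLess_infinite_Field_regularCard r(2) s) simp_all
  moreover have "(\<Union>c\<in>s ` M. {a \<in> M. s a = c}) = M"
    by blast
  ultimately show False
    using M not_ordLess_ordIso by auto
qed

section \<open>Independent families\<close>

lemma separated_pairs_reindex:
  assumes "separated_pairs X G I" "h ` L \<subseteq> I"
  shows "separated_pairs X (G \<circ> map_prod h id) L"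
  using assms unfolding separated_pairs_def by auto

lemma independent_over_reindex:
  fixes h :: "'l \<Rightarrow> 'i"
  assumes "independent_over \<S> G I" "inj_on h L" "h ` L \<subseteq> I"
  shows "independent_over \<S> (G \<circ> map_prod h id) L"
  unfolding independent_over_def
proof (intro ballI allI impI)
  fix H and \<rho> :: "('l \<times> bool) set"
  assume H: "H \<in> \<S>" and \<rho>: "finite \<rho> \<and> \<rho> \<subseteq> L \<times> UNIV \<and> inj_on fst \<rho>"
  let ?\<rho> = "map_prod h id ` \<rho>"
  have "inj_on fst ?\<rho>"
  proof (rule inj_onI)
    fix u v assume "u \<in> ?\<rho>" "v \<in> ?\<rho>" "fst u = fst v"
    then obtain x y where xy: "x \<in> \<rho>" "y \<in> \<rho>" "u = map_prod h id x" "v = map_prod h id y"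
        "h (fst x) = h (fst y)"
      by auto
    moreover have "fst x \<in> L" "fst y \<in> L"
      using xy \<rho> by auto
    ultimately have "fst x = fst y"
      using assms(2) by (meson inj_onD)
    then show "u = v"
      using xy \<rho> by (metis inj_onD)
  qed
  moreover have "finite ?\<rho>" "?\<rho> \<subseteq> I \<times> UNIV"
    using \<rho> assms(3) by auto
  ultimately have "H \<inter> \<Inter>(G ` ?\<rho>) \<noteq> {}"
    using assms(1) H unfolding independent_over_def by blast
  then show "H \<inter> \<Inter>((G \<circ> map_prod h id) ` \<rho>) \<noteq> {}"
    by (simp add: image_comp)
qed

section \<open>Blocks of regular length\<close>

text \<open>Pairs are chosen along \<open>r\<close>; the pair at \<open>a\<close> is good only below a condition
  \<open>(H, \<rho>)\<close> with \<open>\<rho>\<close> a finite choice of sides of earlier pairs, and pressing down makes this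
  condition constant. The conditions considered are those for which \<open>\<rho>\<close> meets every member
  of \<open>\<S>\<close> below \<open>H\<close>, so that \<open>\<rho>\<close> can be dropped in the end.\<close>

lemma independent_block_regular:
  fixes X :: "'a topology" and r :: "'b rel"
  assumes X: "compactum X" and r: "Card_order r" "regularCard r" "natLeq <o r"
    and nb: "\<And>p \<B>. p \<in> topspace X \<Longrightarrow> |\<B>| <o r \<Longrightarrow> \<not> local_pi_base X p \<B>"
    and \<S>: "\<And>H. H \<in> \<S> \<Longrightarrow> openin X H \<and> H \<noteq> {}" "\<S> \<noteq> {}" "|\<S>| <o r"
  shows "\<exists>H\<in>\<S>. \<exists>I \<subseteq> Field r. |I| =o r \<and>
           (\<exists>G. separated_pairs X G I \<and> independent_over {H'\<in>\<S>. H' \<subseteq> H} G I)"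
proof -
  \<comment> \<open>The value \<open>f a\<close> consists of a condition \<open>(H, \<rho>)\<close>
    and the two sides of the pair at \<open>a\<close>; \<open>side\<close> extracts a side.\<close>
  define side :: "('b \<Rightarrow> ('a set \<times> ('b \<times> bool) set) \<times> (bool \<Rightarrow> 'a set)) \<Rightarrow> 'b \<times> bool \<Rightarrow> 'a set"
    where "side f x = snd (f (fst x)) (snd x)" for f x
  \<comment> \<open>These are the persistent conditions at \<open>a\<close>. Nonempty intersections
    take the place of a consistency requirement, as opposite sides of a chosen pair are
    disjoint.\<close>
  define pers :: "('b \<Rightarrow> ('a set \<times> ('b \<times> bool) set) \<times> (bool \<Rightarrow> 'a set)) \<Rightarrow> 'b
      \<Rightarrow> ('a set \<times> ('b \<times> bool) set) set"
    where "pers f a = {(H, \<rho>). H \<in> \<S> \<and> \<rho> \<in> Fpow (underS r a \<times> UNIV) \<and>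
             (\<forall>H'\<in>\<S>. H' \<subseteq> H \<longrightarrow> H' \<inter> \<Inter>(side f ` \<rho>) \<noteq> {})}" for f a
  define cell where "cell f s = fst s \<inter> \<Inter>(side f ` snd s)" for f s
  \<comment> \<open>Both new sides meet each persistent cell inside the cell of the chosen
    condition. The guard leaves indices outside \<open>Field r\<close> unconstrained, since the
    recursion runs over the whole type.\<close>
  define P where "P f a y \<longleftrightarrow> a \<in> Field r \<longrightarrow> fst y \<in> pers f a \<and>
      openin X (snd y True) \<and> openin X (snd y False) \<and>
      disjnt (X closure_of (snd y True)) (X closure_of (snd y False)) \<and>
      (\<forall>s\<in>pers f a. cell f s \<subseteq> cell f (fst y) \<longrightarrow> (\<forall>b. cell f s \<inter> snd y b \<noteq> {}))" for f a y
  have wo: "Well_order r" and wf: "wf (r - Id)"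
    using r(1) by (auto simp: card_order_on_def well_order_on_def)
  have conds_small: "|\<S> \<times> Fpow (A \<times> (UNIV :: bool set))| <o r" if "|A| <o r" for A :: "'b set"
  proof -
    have "|UNIV :: bool set| <o r"
      by (rule countable_ordLess[OF r(3)]) simp
    then show ?thesis
      using r that \<S>(3) by (intro card_of_Times_ordLess_infinite_Field card_of_Fpow_ordLess)
  qed
  have "\<exists>f. \<forall>a. P f a (f a)"
  proof (rule dependent_wf_choice[OF wf])
    fix f g :: "'b \<Rightarrow> ('a set \<times> ('b \<times> bool) set) \<times> (bool \<Rightarrow> 'a set)" and a y
    assume eq: "\<And>z. (z, a) \<in> r - Id \<Longrightarrow> f z = g z"
    \<comment> \<open>\<open>P f a\<close> consults \<open>f\<close> only strictly below
      \<open>a\<close>.\<close>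
    have s: "side f ` \<rho> = side g ` \<rho>" if "\<rho> \<in> Fpow (underS r a \<times> UNIV)" for \<rho>
      using that eq unfolding side_def Fpow_def underS_def by (intro image_cong) auto
    have p: "pers f a = pers g a"
    proof (rule set_eqI)
      fix t :: "'a set \<times> ('b \<times> bool) set"
      show "t \<in> pers f a \<longleftrightarrow> t \<in> pers g a"
      proof (cases "snd t \<in> Fpow (underS r a \<times> UNIV)")
        case True
        then show ?thesis
          using s[OF True] unfolding pers_def by (simp add: case_prod_beta)
      qed (simp add: pers_def case_prod_beta)
    qed
    have c: "cell f t = cell g t" if "t \<in> pers g a" for t
    proof -
      have "snd t \<in> Fpow (underS r a \<times> UNIV)"
        using that by (simp add: pers_def case_prod_beta)
      then show ?thesis
        using s[of "snd t"] by (simp add: cell_def)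
    qed
    show "P f a y = P g a y"
      unfolding P_def p using c by (metis (no_types, lifting))
  next
    fix a f assume IH: "\<And>b. (b, a) \<in> r - Id \<Longrightarrow> P f b (f b)"
    show "\<exists>y. P f a y"
    proof (cases "a \<in> Field r")
      case True
      have op: "openin X (side f x)" if "x \<in> underS r a \<times> UNIV" for x
      proof -
        obtain c b where x: "x = (c, b)" "c \<in> underS r a"
          using \<open>x \<in> _\<close> by auto
        then have "P f c (f c)" "c \<in> Field r"
          using IH by (auto simp: underS_def Field_def)
        then show ?thesis
          unfolding P_def side_def x by (cases b) auto
      qed
      \<comment> \<open>These cells are nonempty, open and fewer than \<open>r\<close>, hence a
        local \<pi>-base at no point; \<open>separated_pair_exists\<close> then supplies the next
        pair.\<close>
      let ?T = "cell f ` pers f a"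
      have 1: "openin X H \<and> H \<noteq> {}" if H: "H \<in> ?T" for H
      proof -
        obtain H1 \<rho> where s: "(H1, \<rho>) \<in> pers f a" "H = H1 \<inter> \<Inter>(side f ` \<rho>)"
          using H unfolding cell_def by force
        then have \<rho>: "finite \<rho>" "\<rho> \<subseteq> underS r a \<times> UNIV" "H1 \<in> \<S>" "H \<noteq> {}"
          unfolding pers_def Fpow_def by auto
        have "openin X H"
        proof (cases "\<rho> = {}")
          case False
          then have "openin X (\<Inter>(side f ` \<rho>))"
            using \<rho> op by (intro openin_Inter) auto
          then show ?thesis
            using s(2) \<S>(1)[OF \<rho>(3)] by blast
        qed (use s(2) \<S>(1)[OF \<rho>(3)] in simp)
        then show ?thesis
          using \<rho>(4) by blast
      qed
      obtain H0 where "H0 \<in> \<S>"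
        using \<S>(2) by blast
      then have "(H0, {}) \<in> pers f a"
        using \<S>(1) unfolding pers_def Fpow_def by auto
      then have 2: "?T \<noteq> {}"
        by blast
      have "|?T| \<le>o |\<S> \<times> Fpow (underS r a \<times> (UNIV :: bool set))|"
      proof -
        have "pers f a \<subseteq> \<S> \<times> Fpow (underS r a \<times> (UNIV :: bool set))"
          unfolding pers_def by auto
        then show ?thesis
          using card_of_image card_of_mono1 ordLeq_transitive by blast
      qed
      then have "|?T| <o r"
        using conds_small[OF card_of_underS[OF r(1) True]] ordLeq_ordLess_trans by blast
      then have 3: "\<not> local_pi_base X p ?T" if "p \<in> topspace X" for p
        using nb that by blast
      obtain s O1 O2 where s: "s \<in> pers f a" and O: "openin X O1" "openin X O2"
        "disjnt (X closure_of O1) (X closure_of O2)"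
        "\<forall>H'\<in>?T. H' \<subseteq> cell f s \<longrightarrow> H' \<inter> O1 \<noteq> {} \<and> H' \<inter> O2 \<noteq> {}"
        using separated_pair_exists[OF X 1 2 3] by (metis (no_types, lifting) imageE)
      have "P f a (s, \<lambda>b. if b then O1 else O2)"
        unfolding P_def using s O by auto
      then show ?thesis ..
    qed (simp add: P_def)
  qed
  then obtain f where f: "\<And>a. a \<in> Field r \<Longrightarrow> P f a (f a)"
    unfolding P_def by blast
  define D where "D a = fst ` snd (fst (f a))" for a
  have fp: "fst (f a) \<in> pers f a" if "a \<in> Field r" for a
    using f[OF that] that unfolding P_def by blast
  have D: "finite (D a) \<and> D a \<subseteq> underS r a" if "a \<in> Field r" for a
    using fp[OF that] unfolding pers_def D_def Fpow_def by auto
  obtain d where d: "d \<in> Field r" "|{a \<in> Field r. D a \<subseteq> under r d}| =o r"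
    using regressive_finite_sets[OF r, of D] D by blast
  define M where "M = {a \<in> Field r. D a \<subseteq> under r d}"
  \<comment> \<open>On \<open>M\<close> the conditions mention only indices up to \<open>d\<close>,
    so fewer than \<open>r\<close> are available and one of them serves \<open>r\<close> many
    indices.\<close>
  have "|(fst \<circ> f) ` M| <o r"
  proof -
    have "(fst \<circ> f) ` M \<subseteq> \<S> \<times> Fpow (under r d \<times> UNIV)"
    proof (rule image_subsetI)
      fix a assume a: "a \<in> M"
      then have "fst (f a) \<in> pers f a" "fst ` snd (fst (f a)) \<subseteq> under r d"
        using fp unfolding M_def D_def by auto
      then show "(fst \<circ> f) a \<in> \<S> \<times> Fpow (under r d \<times> UNIV)"
        unfolding pers_def Fpow_def by force
    qed
    moreover have "|under r d| <o r"
      by (rule card_of_under_ordLess[OF r(3,1) d(1)])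
    ultimately show ?thesis
      using conds_small card_of_mono1 ordLeq_ordLess_trans by blast
  qed
  then obtain c where c: "c \<in> (fst \<circ> f) ` M" "|{a \<in> M. (fst \<circ> f) a = c}| =o r"
    using regularCard_constant_on_large[OF r d(2)] unfolding M_def by blast
  obtain H \<rho>0 where Hc: "c = (H, \<rho>0)"
    by fastforce
  define I where "I = {a \<in> M. (fst \<circ> f) a = c}"
  have I: "a \<in> Field r" "fst (f a) = (H, \<rho>0)" if "a \<in> I" for a
    using that Hc unfolding I_def M_def by auto
  obtain a0 where "a0 \<in> I"
    using c unfolding I_def by auto
  have HS: "H \<in> \<S>" and fin0: "finite \<rho>0"
    and H0: "\<And>H'. H' \<in> \<S> \<Longrightarrow> H' \<subseteq> H \<Longrightarrow> H' \<inter> \<Inter>(side f ` \<rho>0) \<noteq> {}"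
    using fp[OF I(1)[OF \<open>a0 \<in> I\<close>]] I(2)[OF \<open>a0 \<in> I\<close>] unfolding pers_def Fpow_def by auto
  have sub0: "\<rho>0 \<subseteq> underS r a \<times> UNIV" if "a \<in> I" for a
    using fp[OF I(1)[OF that]] I(2)[OF that] unfolding pers_def Fpow_def by auto
  \<comment> \<open>The greatest index \<open>a\<close> of \<open>\<rho>\<close> is removed.
    Generality in \<open>H'\<close> matters: the induction hypothesis for all smaller members of
    \<open>\<S>\<close> makes \<open>(H', \<rho>0 \<union> \<rho>')\<close> persistent at
    \<open>a\<close>. Its cell lies in that of \<open>(H, \<rho>0)\<close>, so it meets both sides
    at \<open>a\<close>.\<close>
  have key: "H' \<inter> \<Inter>(side f ` (\<rho>0 \<union> \<rho>)) \<noteq> {}"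
    if "finite \<rho>" "\<rho> \<subseteq> I \<times> UNIV" "inj_on fst \<rho>" "H' \<in> \<S>" "H' \<subseteq> H" for \<rho> H'
    using that
  proof (induction "card \<rho>" arbitrary: \<rho> H')
    case 0
    then show ?case
      using H0 by simp
  next
    case (Suc n)
    have "fst ` \<rho> \<subseteq> Field r" "fst ` \<rho> \<noteq> {}" "finite (fst ` \<rho>)"
      using Suc I(1) by auto
    then obtain a b where ab: "(a, b) \<in> \<rho>" and amax: "fst ` \<rho> \<subseteq> under r a"
      using Well_order_finite_has_max[OF wo, of "fst ` \<rho>"]
      by (metis (no_types, lifting) imageE prod.collapse)
    define \<rho>' where "\<rho>' = \<rho> - {(a, b)}"
    have aI: "a \<in> I"
      using ab Suc.prems(2) by blast
    have below: "\<rho>' \<subseteq> underS r a \<times> UNIV"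
    proof
      fix x assume x: "x \<in> \<rho>'"
      then have "fst x \<noteq> a"
        using ab Suc.prems(3) unfolding \<rho>'_def inj_on_def by force
      moreover have "fst x \<in> under r a"
        using amax x unfolding \<rho>'_def by blast
      ultimately have "fst x \<in> underS r a"
        by (auto simp: under_def underS_def)
      then show "x \<in> underS r a \<times> UNIV"
        by (metis SigmaI UNIV_I prod.collapse)
    qed
    have IH: "H'' \<inter> \<Inter>(side f ` (\<rho>0 \<union> \<rho>')) \<noteq> {}" if "H'' \<in> \<S>" "H'' \<subseteq> H" for H''
    proof (rule Suc.hyps(1))
      show "n = card \<rho>'"
        using Suc.hyps(2) ab Suc.prems(1) unfolding \<rho>'_def by simp
      show "inj_on fst \<rho>'"
        using Suc.prems(3) unfolding \<rho>'_def by (rule inj_on_subset) blast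
    qed (use that Suc.prems in \<open>auto simp: \<rho>'_def\<close>)
    have "(H', \<rho>0 \<union> \<rho>') \<in> pers f a"
      using Suc.prems IH below sub0[OF aI] fin0 unfolding pers_def Fpow_def
      by (auto simp: \<rho>'_def)
    moreover have "cell f (H', \<rho>0 \<union> \<rho>') \<subseteq> cell f (fst (f a))"
      using Suc.prems(5) unfolding cell_def I(2)[OF aI] by auto
    ultimately have "cell f (H', \<rho>0 \<union> \<rho>') \<inter> snd (f a) b \<noteq> {}"
      using f[OF I(1)[OF aI]] I(1)[OF aI] unfolding P_def by blast
    moreover have "\<rho> = insert (a, b) \<rho>'"
      using ab unfolding \<rho>'_def by blast
    then have "H' \<inter> \<Inter>(side f ` (\<rho>0 \<union> \<rho>)) = cell f (H', \<rho>0 \<union> \<rho>') \<inter> snd (f a) b"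
      unfolding cell_def side_def by auto
    ultimately show ?case
      by simp
  qed
  have "independent_over {H'\<in>\<S>. H' \<subseteq> H} (side f) I"
    unfolding independent_over_def
  proof (intro ballI allI impI)
    fix H' and \<rho> :: "('b \<times> bool) set"
    assume "H' \<in> {H'\<in>\<S>. H' \<subseteq> H}" "finite \<rho> \<and> \<rho> \<subseteq> I \<times> UNIV \<and> inj_on fst \<rho>"
    then show "H' \<inter> \<Inter>(side f ` \<rho>) \<noteq> {}"
      using key[of \<rho> H'] by auto
  qed
  moreover have "separated_pairs X (side f) I"
    using f I(1) unfolding separated_pairs_def P_def side_def by simp
  moreover have "I \<subseteq> Field r" "|I| =o r"
    using I(1) c(2) unfolding I_def by auto
  ultimately show ?thesis
    using HS by blast
qed

text \<open>An arbitrary \<open>L\<close> of size at most \<open>r\<close> allows \<open>r\<close>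
  to be an auxiliary regular cardinal unrelated to the index set of the block.\<close>

corollary independent_block:
  fixes X :: "'a topology" and r :: "'b rel" and L :: "'l set"
  assumes X: "compactum X" and r: "Card_order r" "regularCard r" "natLeq <o r"
    and nb: "\<And>p \<B>. p \<in> topspace X \<Longrightarrow> |\<B>| <o r \<Longrightarrow> \<not> local_pi_base X p \<B>"
    and \<S>: "\<And>H. H \<in> \<S> \<Longrightarrow> openin X H \<and> H \<noteq> {}" "\<S> \<noteq> {}" "|\<S>| <o r"
    and L: "|L| \<le>o r"
  shows "\<exists>H\<in>\<S>. \<exists>G. separated_pairs X G L \<and> independent_over {H'\<in>\<S>. H' \<subseteq> H} G L"
proof -
  obtain H G and I :: "'b set" where H: "H \<in> \<S>" and I: "|I| =o r"
    and G: "separated_pairs X G I" "independent_over {H'\<in>\<S>. H' \<subseteq> H} G I"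
    using independent_block_regular[OF X r nb \<S>] by auto
  have "|L| \<le>o |I|"
    using L I ordIso_symmetric ordLeq_ordIso_trans by blast
  then obtain h where h: "inj_on h L" "h ` L \<subseteq> I"
    using card_of_ordLeq by metis
  show ?thesis
    using H separated_pairs_reindex[OF G(1) h(2)] independent_over_reindex[OF G(2) h] by blast
qed

section \<open>Gluing blocks at a singular cardinal\<close>

text \<open>Blocks are added along a cofinal set \<open>C\<close> of fewer than \<open>|K|\<close> indices, the block at
  \<open>c\<close> having coordinates \<open>(c, x)\<close> with \<open>x\<close> up to \<open>c\<close>. Each block is independent
  only below a finite condition, and the successive conditions are kept compatible; they use up
  fewer than \<open>|K|\<close> coordinates altogether, which are discarded.\<close>

lemma independent_family_singular:
  fixes X :: "'a topology" and K :: "'k set"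
  assumes X: "compactum X" "topspace X \<noteq> {}" and K: "natLeq <o |K|" "\<not> regularCard |K|"
    and nb: "\<And>p \<B>. p \<in> topspace X \<Longrightarrow> |\<B>| <o |K| \<Longrightarrow> \<not> local_pi_base X p \<B>"
  shows "\<exists>G. separated_pairs X G K \<and> independent_over {topspace X} G K"
proof -
  define r where "r = |K|"
  have rF: "Field r = K" and card: "Card_order r" and wo: "Well_order r"
    unfolding r_def by (rule Field_card_of card_of_Card_order card_of_Well_order)+
  have wf: "wf (r - Id)" and tr: "trans r" and as: "antisym r"
    using wo by (auto simp: order_on_defs)
  have rnat: "natLeq <o r"
    using K(1) by (simp add: r_def)
  have inf: "infinite (Field r)"
    using rnat by (rule infinite_Field_of_natLeq_ordLess)
  obtain C where C: "C \<subseteq> K" "cofinal C r" "\<not> |C| =o r"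
    using K(2) rF unfolding regularCard_def r_def by auto
  have Cless: "|C| <o r"
    using card_of_mono1[OF C(1)] C(3) ordLeq_iff_ordLess_or_ordIso unfolding r_def by blast
  \<comment> \<open>The value \<open>f c\<close> consists of the condition chosen for block
    \<open>c\<close> and the pairs of that block; the index \<open>(c, x)\<close> denotes pair
    \<open>x\<close> of block \<open>c\<close>.\<close>
  define side :: "('k \<Rightarrow> (('k \<times> 'k) \<times> bool) set \<times> ('k \<times> bool \<Rightarrow> 'a set)) \<Rightarrow> ('k \<times> 'k) \<times> bool \<Rightarrow> 'a set"
    where "side f x = snd (f (fst (fst x))) (snd (fst x), snd x)" for f x
  define cell where "cell f \<rho> = topspace X \<inter> \<Inter>(side f ` \<rho>)" for f \<rho>
  define chosen where "chosen f J = (\<Union>j\<in>J. fst (f j))"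
    for f :: "'k \<Rightarrow> (('k \<times> 'k) \<times> bool) set \<times> ('k \<times> bool \<Rightarrow> 'a set)" and J
  \<comment> \<open>Finite choices of sides from the blocks in \<open>J\<close> that are consistent
    with every condition chosen in \<open>J\<close>.\<close>
  define conds where "conds f J =
      {\<rho> \<in> Fpow (Sigma J (under r) \<times> UNIV). inj_on fst (\<rho> \<union> chosen f J)}" for f J
  define L where "L c = C \<inter> underS r c" for c
  define P where "P f c y \<longleftrightarrow> c \<in> C \<longrightarrow> fst y \<in> conds f (L c) \<and>
      separated_pairs X (snd y) (under r c) \<and>
      independent_over {H \<in> cell f ` conds f (L c). H \<subseteq> cell f (fst y)} (snd y) (under r c)" for f c y
  have LL: "L j \<subseteq> L c" if "j \<in> L c" for j c
    using that transD[OF tr] antisymD[OF as] unfolding L_def underS_def by blast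
  \<comment> \<open>Of two blocks, the later had its condition chosen consistently with that of the
    earlier.\<close>
  have lin: "inj_on fst (chosen f J)" if J: "J \<subseteq> C" "\<And>j. j \<in> J \<Longrightarrow> L j \<subseteq> J"
    and P: "\<And>j. j \<in> J \<Longrightarrow> P f j (f j)" for f J
  proof (rule inj_onI)
    fix x y assume "x \<in> chosen f J" "y \<in> chosen f J" and eq: "fst x = fst y"
    then obtain i j where ij: "i \<in> J" "x \<in> fst (f i)" "j \<in> J" "y \<in> fst (f j)"
      unfolding chosen_def by blast
    have *: "inj_on fst (fst (f j) \<union> chosen f (L j))" if "j \<in> J" for j
      using P[OF that] that J(1) unfolding P_def conds_def by blast
    have "(i, j) \<in> r \<or> (j, i) \<in> r"
      using Well_order_linear[OF wo] ij J(1) C(1) rF by blast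
    then consider "i = j" | "i \<in> L j" | "j \<in> L i"
      using ij J(1) unfolding L_def underS_def by blast
    then show "x = y"
    proof cases
      case 1
      then show ?thesis
        using *[OF ij(1)] ij eq by (metis UnI1 inj_onD)
    next
      case 2
      then have "x \<in> chosen f (L j)"
        using ij unfolding chosen_def by blast
      then show ?thesis
        using *[OF ij(3)] ij(4) eq by (metis UnI1 UnI2 inj_onD)
    next
      case 3
      then have "y \<in> chosen f (L i)"
        using ij unfolding chosen_def by blast
      then show ?thesis
        using *[OF ij(1)] ij(2) eq by (metis UnI1 UnI2 inj_onD)
    qed
  qed
  \<comment> \<open>Let \<open>m\<close> be the last block occurring in \<open>\<rho>\<close>, with
    \<open>\<rho>2\<close> the part of \<open>\<rho>\<close> in block \<open>m\<close> and
    \<open>\<rho>1\<close> the rest. Consistency with the chosen conditions makes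
    \<open>\<rho>1 \<union> fst (f m)\<close> an admissible condition below the one for
    \<open>m\<close>, and independence of block \<open>m\<close> over its cell handles
    \<open>\<rho>2\<close>.\<close>
  have cell_ne: "cell f \<rho> \<noteq> {}" if J: "J \<subseteq> C" "\<And>j. j \<in> J \<Longrightarrow> L j \<subseteq> J"
    and P: "\<And>j. j \<in> J \<Longrightarrow> P f j (f j)" and \<rho>: "\<rho> \<in> conds f J" for f J \<rho>
  proof (cases "\<rho> = {}")
    case True
    then show ?thesis
      using X(2) by (simp add: cell_def)
  next
    case False
    let ?B = "(fst \<circ> fst) ` \<rho>"
    have \<rho>J: "\<rho> \<subseteq> Sigma J (under r) \<times> UNIV" "finite \<rho>" and inj: "inj_on fst (\<rho> \<union> chosen f J)"
      using \<rho> unfolding conds_def Fpow_def by auto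
    have BJ: "?B \<subseteq> J"
      using \<rho>J by auto
    then have "?B \<subseteq> Field r"
      using J(1) C(1) rF by blast
    then obtain m where m: "m \<in> ?B" "?B \<subseteq> under r m"
      using Well_order_finite_has_max[OF wo, of ?B] \<rho>J(2) False by blast
    have mJ: "m \<in> J" "m \<in> C"
      using m(1) BJ J(1) by auto
    define \<rho>1 where "\<rho>1 = {x \<in> \<rho>. fst (fst x) \<noteq> m}"
    define \<rho>2 where "\<rho>2 = {(x, b). ((m, x), b) \<in> \<rho>}"
    have Pm: "fst (f m) \<in> conds f (L m)"
      "independent_over {H \<in> cell f ` conds f (L m). H \<subseteq> cell f (fst (f m))} (snd (f m)) (under r m)"
      using P[OF mJ(1)] mJ(2) unfolding P_def by auto
    have "\<rho>1 \<union> fst (f m) \<in> conds f (L m)"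
    proof -
      have "\<rho>1 \<subseteq> Sigma (L m) (under r) \<times> UNIV"
      proof
        fix x assume x: "x \<in> \<rho>1"
        then have "x \<in> Sigma J (under r) \<times> UNIV" "fst (fst x) \<in> under r m"
          using \<rho>J(1) m(2) unfolding \<rho>1_def by auto
        moreover have "fst (fst x) \<noteq> m"
          using x by (simp add: \<rho>1_def)
        ultimately have "fst (fst x) \<in> L m" "snd (fst x) \<in> under r (fst (fst x))"
          using J(1) unfolding L_def under_def underS_def by auto
        then show "x \<in> Sigma (L m) (under r) \<times> UNIV"
          by (cases x) auto
      qed
      moreover have "\<rho>1 \<union> fst (f m) \<union> chosen f (L m) \<subseteq> \<rho> \<union> chosen f J"
        using mJ J(2)[OF mJ(1)] unfolding \<rho>1_def chosen_def by blast
      then have "inj_on fst (\<rho>1 \<union> fst (f m) \<union> chosen f (L m))"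
        by (rule inj_on_subset[OF inj])
      moreover have "finite \<rho>1"
        using \<rho>J(2) by (simp add: \<rho>1_def)
      ultimately show ?thesis
        using Pm(1) unfolding conds_def Fpow_def by simp
    qed
    then have "cell f (\<rho>1 \<union> fst (f m)) \<in> {H \<in> cell f ` conds f (L m). H \<subseteq> cell f (fst (f m))}"
      by (auto simp: cell_def)
    moreover have "finite \<rho>2"
    proof -
      have "\<rho>2 \<subseteq> (\<lambda>x. (snd (fst x), snd x)) ` \<rho>"
        unfolding \<rho>2_def by force
      then show ?thesis
        using \<rho>J(2) finite_surj by blast
    qed
    moreover have "\<rho>2 \<subseteq> under r m \<times> UNIV"
      using \<rho>J(1) unfolding \<rho>2_def by auto
    moreover have "inj_on fst \<rho>2"
    proof (rule inj_onI)
      fix x y assume xy: "x \<in> \<rho>2" "y \<in> \<rho>2" "fst x = fst y"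
      then have "((m, fst x), snd x) \<in> \<rho>" "((m, fst y), snd y) \<in> \<rho>"
        unfolding \<rho>2_def by auto
      then have "((m, fst x), snd x) = ((m, fst y), snd y)"
        using inj xy(3) by (intro inj_onD[OF inj]) auto
      then show "x = y"
        using xy(3) by (simp add: prod_eq_iff)
    qed
    ultimately have "cell f (\<rho>1 \<union> fst (f m)) \<inter> \<Inter>(snd (f m) ` \<rho>2) \<noteq> {}"
      using Pm(2) unfolding independent_over_def by blast
    moreover have "cell f (\<rho>1 \<union> fst (f m)) \<inter> \<Inter>(snd (f m) ` \<rho>2) \<subseteq> cell f \<rho>"
    proof
      fix z assume z: "z \<in> cell f (\<rho>1 \<union> fst (f m)) \<inter> \<Inter>(snd (f m) ` \<rho>2)"
      have "z \<in> side f x" if x: "x \<in> \<rho>" for x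
      proof (cases "fst (fst x) = m")
        case True
        then have "(snd (fst x), snd x) \<in> \<rho>2"
          using x unfolding \<rho>2_def by (auto simp: prod_eq_iff)
        then show ?thesis
          using z True unfolding side_def by auto
      next
        case False
        then show ?thesis
          using z x unfolding cell_def \<rho>1_def by auto
      qed
      then show "z \<in> cell f \<rho>"
        using z unfolding cell_def by auto
    qed
    ultimately show ?thesis
      by blast
  qed
  have openside: "openin X (side f x)" if "J \<subseteq> C" "\<And>j. j \<in> J \<Longrightarrow> P f j (f j)"
    "x \<in> Sigma J (under r) \<times> UNIV" for f J x
  proof -
    have "separated_pairs X (snd (f (fst (fst x)))) (under r (fst (fst x)))"
      using that unfolding P_def by auto
    then show ?thesis
      using separated_pairs_openin[of X _ _ "(snd (fst x), snd x)"] that(3) unfolding side_def by auto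
  qed
  have "\<exists>f. \<forall>c. P f c (f c)"
  proof (rule dependent_wf_choice[OF wf])
    fix f g :: "'k \<Rightarrow> (('k \<times> 'k) \<times> bool) set \<times> ('k \<times> bool \<Rightarrow> 'a set)" and c y
    assume eq: "\<And>z. (z, c) \<in> r - Id \<Longrightarrow> f z = g z"
    have eqL: "f j = g j" if "j \<in> L c" for j
      using eq that unfolding L_def underS_def by auto
    have "chosen f (L c) = chosen g (L c)"
      using eqL unfolding chosen_def by simp
    then have cd: "conds f (L c) = conds g (L c)"
      by (simp add: conds_def)
    have ce: "cell f \<rho> = cell g \<rho>" if "\<rho> \<in> conds g (L c)" for \<rho>
    proof -
      have "side f x = side g x" if "x \<in> \<rho>" for x
        using \<open>\<rho> \<in> _\<close> that eqL unfolding conds_def Fpow_def side_def by auto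
      then show ?thesis
        unfolding cell_def by simp
    qed
    have im: "cell f ` conds g (L c) = cell g ` conds g (L c)"
      using ce by (rule image_cong[OF refl])
    show "P f c y = P g c y"
      unfolding P_def cd im using ce[of "fst y"] by (cases "fst y \<in> conds g (L c)") simp_all
  next
    fix c f assume IH: "\<And>b. (b, c) \<in> r - Id \<Longrightarrow> P f b (f b)"
    show "\<exists>y. P f c y"
    proof (cases "c \<in> C")
      case True
      have cF: "c \<in> Field r"
        using True C(1) rF by blast
      have J: "L c \<subseteq> C" "\<And>j. j \<in> L c \<Longrightarrow> P f j (f j)" "\<And>j. j \<in> L c \<Longrightarrow> L j \<subseteq> L c"
        using IH LL by (auto simp: L_def underS_def)
      let ?S = "cell f ` conds f (L c)"
      have 1: "openin X H \<and> H \<noteq> {}" if HS: "H \<in> ?S" for H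
      proof -
        obtain \<rho> where \<rho>: "\<rho> \<in> conds f (L c)" "H = cell f \<rho>"
          using HS by blast
        have "openin X (cell f \<rho>)"
        proof (cases "\<rho> = {}")
          case False
          then show ?thesis
            using \<rho>(1) openside[OF J(1,2)] unfolding cell_def conds_def Fpow_def
            by (intro openin_Int openin_Inter) auto
        qed (simp add: cell_def)
        then show ?thesis
          using cell_ne[OF J(1,3,2) \<rho>(1)] \<rho>(2) by simp
      qed
      have "{} \<in> conds f (L c)"
        using lin[OF J(1,3,2)] unfolding conds_def Fpow_def by simp
      then have 2: "?S \<noteq> {}"
        by blast
      have under: "|under r c| <o r"
        by (rule card_of_under_ordLess[OF rnat card cF])
      have Sless: "|?S| <o r"
      proof -
        have "Sigma (L c) (under r) \<subseteq> C \<times> under r c"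
          using tr unfolding L_def under_def underS_def trans_def by blast
        then have "conds f (L c) \<subseteq> Fpow ((C \<times> under r c) \<times> UNIV)"
          unfolding conds_def Fpow_def by blast
        moreover have "|UNIV :: bool set| <o r"
          by (rule countable_ordLess[OF rnat]) simp
        then have "|Fpow ((C \<times> under r c) \<times> (UNIV :: bool set))| <o r"
          using rnat card Cless under
          by (intro card_of_Fpow_ordLess card_of_Times_ordLess_infinite_Field)
        ultimately have "|conds f (L c)| <o r"
          using card_of_mono1 ordLeq_ordLess_trans by blast
        then show ?thesis
          using card_of_image ordLeq_ordLess_trans by blast
      qed
      \<comment> \<open>The successor of \<open>|?B|\<close> is regular and uncountable, exceeds the
        number of cells and the length of the block, and is still at most \<open>r\<close>, so the
        regular case applies to it.\<close>
      let ?B = "?S <+> (under r c <+> (UNIV :: nat set))"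
      define r' where "r' = cardSuc |?B|"
      have cB: "Card_order |?B|" and iB: "infinite ?B"
        by (auto simp: card_of_Card_order)
      have "|UNIV :: nat set| <o r"
        by (rule countable_ordLess[OF rnat]) simp
      then have "|?B| <o r"
        using inf card Sless under by (intro card_of_Plus_ordLess_infinite_Field)
      then have r'r: "r' \<le>o r"
        unfolding r'_def using cB card by (simp add: cardSuc_ordLess_ordLeq)
      have r': "Card_order r'" "regularCard r'"
        unfolding r'_def using cB iB by (simp_all add: cardSuc_Card_order infinite_cardSuc_regularCard Field_card_of)
      have less: "|?B| <o r'"
        unfolding r'_def using cB by (rule cardSuc_greater)
      have "|?S| \<le>o |?B|" "|under r c| \<le>o |?B|" "|UNIV :: nat set| \<le>o |?B|"
        by (meson card_of_Plus1 card_of_Plus2 ordLeq_transitive)+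
      then have lS: "|?S| <o r'" and lU: "|under r c| \<le>o r'" and "|UNIV :: nat set| <o r'"
        using less ordLeq_ordLess_trans ordLess_imp_ordLeq by blast+
      then have nr': "natLeq <o r'"
        using card_of_nat ordIso_ordLess_trans ordIso_symmetric by blast
      have 3: "\<not> local_pi_base X p \<B>" if "p \<in> topspace X" "|\<B>| <o r'" for p \<B>
        using nb[OF that(1)] that(2) r'r ordLess_ordLeq_trans unfolding r_def by blast
      obtain H G where H: "H \<in> ?S" and G: "separated_pairs X G (under r c)"
        "independent_over {H'\<in>?S. H' \<subseteq> H} G (under r c)"
        using independent_block[OF X(1) r' nr' 3 1 2 lS lU] by blast
      obtain \<rho> where "\<rho> \<in> conds f (L c)" "H = cell f \<rho>"
        using H by blast
      then have "P f c (\<rho>, G)"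
        unfolding P_def using G by simp
      then show ?thesis ..
    qed (simp add: P_def)
  qed
  then obtain f where f: "\<And>c. P f c (f c)"
    by blast
  define S where "S = chosen f C"
  \<comment> \<open>Dropping the coordinates used by the chosen conditions makes every finite choice
    on \<open>I\<close> consistent with all of them.\<close>
  define I where "I = Sigma C (under r) - fst ` S"
  have LC: "L j \<subseteq> C" for j
    by (auto simp: L_def)
  have sep: "separated_pairs X (side f) I"
    unfolding separated_pairs_def
  proof
    fix i assume "i \<in> I"
    then have i: "fst i \<in> C" "snd i \<in> under r (fst i)"
      unfolding I_def by auto
    then have "separated_pairs X (snd (f (fst i))) (under r (fst i))"
      using f[of "fst i"] unfolding P_def by blast
    then show "openin X (side f (i, True)) \<and> openin X (side f (i, False)) \<and>
        disjnt (X closure_of side f (i, True)) (X closure_of side f (i, False))"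
      using i unfolding separated_pairs_def side_def by simp
  qed
  have ind: "independent_over {topspace X} (side f) I"
    unfolding independent_over_def
  proof (intro ballI allI impI)
    fix H and \<rho> :: "(('k \<times> 'k) \<times> bool) set"
    assume H: "H \<in> {topspace X}" and \<rho>: "finite \<rho> \<and> \<rho> \<subseteq> I \<times> UNIV \<and> inj_on fst \<rho>"
    have "fst ` \<rho> \<inter> fst ` S = {}"
      using \<rho> unfolding I_def by auto
    then have "inj_on fst (\<rho> \<union> S)"
      using \<rho> lin[OF order_refl LC f] unfolding S_def by (auto simp: inj_on_Un)
    then have "\<rho> \<in> conds f C"
      using \<rho> unfolding conds_def Fpow_def S_def I_def by auto
    then have "cell f \<rho> \<noteq> {}"
      by (intro cell_ne[of C f] LC f order_refl)
    then show "H \<inter> \<Inter>(side f ` \<rho>) \<noteq> {}"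
      using H by (simp add: cell_def)
  qed
  have "|K| \<le>o |I|"
  proof (rule ccontr)
    assume "\<not> |K| \<le>o |I|"
    then have "|I| <o r"
      using ordLess_or_ordLeq[OF card_of_Well_order card_of_Well_order, of I K] by (auto simp: r_def)
    moreover have "|fst ` S| <o r"
    proof -
      let ?B = "C <+> (UNIV :: nat set)"
      have "|UNIV :: nat set| <o r"
        by (rule countable_ordLess[OF rnat]) simp
      then have B: "|?B| <o r"
        using inf card Cless by (intro card_of_Plus_ordLess_infinite_Field)
      have "|fst (f j)| \<le>o |?B|" if "j \<in> C" for j
      proof -
        have "finite (fst (f j))"
          using f[of j] that unfolding P_def conds_def Fpow_def by blast
        then have "|fst (f j)| \<le>o |UNIV :: nat set|"
          by (metis card_of_ordLeq countable_def countable_finite top_greatest)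
        then show ?thesis
          using card_of_Plus2 ordLeq_transitive by blast
      qed
      then have "|S| \<le>o |?B|"
        unfolding S_def chosen_def
        by (intro card_of_UNION_ordLeq_infinite) (auto simp: card_of_Plus1)
      then show ?thesis
        using B card_of_image ordLeq_transitive ordLeq_ordLess_trans by blast
    qed
    ultimately have "|I \<union> fst ` S| <o r"
      using inf card by (intro card_of_Un_ordLess_infinite_Field)
    \<comment> \<open>Every \<open>k\<close> lies below some \<open>c\<close> in the cofinal set
      \<open>C\<close>, so it is a coordinate of block \<open>c\<close>, whether dropped or
      not.\<close>
    moreover have "K \<subseteq> snd ` (I \<union> fst ` S)"
    proof
      fix k assume "k \<in> K"
      then obtain c where "c \<in> C" "(k, c) \<in> r"
        using C(2) rF unfolding cofinal_def by blast
      then have "(c, k) \<in> I \<union> fst ` S"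
        unfolding I_def by (auto simp: under_def)
      then show "k \<in> snd ` (I \<union> fst ` S)"
        by force
    qed
    then have "r \<le>o |I \<union> fst ` S|"
      unfolding r_def by (rule surj_imp_ordLeq)
    ultimately show False
      using not_ordLess_ordLeq by blast
  qed
  then obtain h where h: "inj_on h K" "h ` K \<subseteq> I"
    using card_of_ordLeq by metis
  show ?thesis
    using separated_pairs_reindex[OF sep h(2)] independent_over_reindex[OF ind h] by blast
qed

theorem theorem5p2:
  fixes X :: "'a topology" and K :: "'k set"
  assumes "compactum X"
    and "uncountable K"
    and "min_pi_character X K"
  shows "\<exists>p\<in>topspace X. \<exists>\<U>. local_splitter X p \<U> K (UNIV :: nat set)"
proof -
  have X: "topspace X \<noteq> {}"
    using assms(3) unfolding min_pi_character_def by blast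
  have K: "natLeq <o |K|"
  proof (rule ccontr)
    assume "\<not> natLeq <o |K|"
    then have "|K| \<le>o natLeq"
      using ordLess_or_ordLeq[OF natLeq_Well_order card_of_Well_order] by blast
    then have "|K| \<le>o |UNIV :: nat set|"
      using card_of_nat ordIso_symmetric ordLeq_ordIso_trans by blast
    then show False
      using assms(2) card_of_ordLeq[of K "UNIV :: nat set"] unfolding countable_def by blast
  qed
  have nb: "\<not> local_pi_base X p \<B>" if p: "p \<in> topspace X" and \<B>: "|\<B>| <o |K|" for p \<B>
  proof
    assume "local_pi_base X p \<B>"
    then have "K \<lesssim> \<B> \<or> K \<lesssim> (UNIV :: nat set)"
      using assms(3) p unfolding min_pi_character_def pi_char_ge_def by blast
    then have "|K| \<le>o |\<B>| \<or> countable K"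
      unfolding lepoll_def countable_def using card_of_ordLeq[of K \<B>] by blast
    then show False
      using assms(2) \<B> not_ordLess_ordLeq by blast
  qed
  have "\<exists>G :: 'k \<times> bool \<Rightarrow> 'a set. separated_pairs X G K \<and> independent_over {topspace X} G K"
  proof (cases "regularCard |K|")
    case True
    have 1: "openin X H \<and> H \<noteq> {}" if "H \<in> {topspace X}" for H
      using that X by simp
    have 2: "|{topspace X}| <o |K|"
      by (rule countable_ordLess[OF K]) simp
    have 3: "|K| \<le>o |K|"
      by (simp add: card_of_mono1)
    \<comment> \<open>With \<open>topspace X\<close> as the only member of \<open>\<S>\<close>,
      independence below \<open>H\<close> is outright independence.\<close>
    have "\<exists>H\<in>{topspace X}. \<exists>G :: 'k \<times> bool \<Rightarrow> 'a set. separated_pairs X G K \<and>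
        independent_over {H'\<in>{topspace X}. H' \<subseteq> H} G K"
      using independent_block[OF assms(1) card_of_Card_order True K nb 1 _ 2 3] by blast
    moreover have "{H'\<in>{topspace X}. H' \<subseteq> topspace X} = {topspace X}"
      by blast
    ultimately show ?thesis
      by simp
  next
    case False
    show ?thesis
      by (rule independent_family_singular[OF assms(1) X K False nb])
  qed
  then show ?thesis
    using local_splitter_of_independent[of X _ K] assms(1) by (auto simp: compactum_def)
qed

end
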